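(* Let $n\ge 2$, let $K_n=(V,E)$ be the complete graph on the vertex set $V$ with $|V|=n$, and let $X,Y$ be two distinct cuts of $K_n$. Then the cones $K^{+}_{\max}(X)$ and $K^{+}_{\max}(Y)$ are adjacent (i.e. $\dim\big(K^{+}_{\max}(X)\cap K^{+}_{\max}(Y)\big)=d-1$, where $d=\binom{n}{2}$) if and only if one of the following holds: (i) $X$ and $Y$ are crossing; or (ii) $|X\ominus Y|=1$, or $|\bar X\ominus Y|=1$, or $|X\ominus\bar Y|=1$, or $|\bar X\ominus\bar Y|=1$, where $\ominus$ denotes symmetric difference and $\bar X=V\setminus X$.
   Context: Let $d=\binom{n}{2}=|E|$. For $S\subseteq V$, the cut vector $\mathbf{v}(S)\in\{0,1\}^{d}$ has coordinates indexed by edges $\{i,j\}\in E$, with $\mathbf{v}(S)_{i,j}=1$ if $|S\cap\{i,j\}|=1$ and $0$ otherwise. A cut is a nonempty proper subset $X\subset V$, where $X$ and its complement $\bar X=V\setminus X$ are identified (they have the same cut vector); the empty cut is excluded, so there are $2^{n-1}-1$ cuts. For a cut $X$, define the convex polyhedral cone $K^{+}_{\max}(X)=\{\mathbf{c}\in\mathbb{R}^{d}:\ \mathbf{c}\ge\mathbf{0},\ \langle\mathbf{c},\mathbf{v}(X)\rangle\ge\langle\mathbf{c},\mathbf{v}(Y)\rangle \text{ for all cuts } Y\}$. These cones form the cone partition of the nonnegative orthant for the max-cut problem with non-negative edge weights. Two such cones $K^{+}_{\max}(X),K^{+}_{\max}(Y)$ ($X\ne Y$) are called adjacent if $\dim\big(K^{+}_{\max}(X)\cap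 K^{+}_{\max}(Y)\big)=d-1$. Two subsets $A,B\subset V$ are crossing if $A\cap B\neq\emptyset$, $A\setminus B\ne\emptyset$, $B\setminus A\neq\emptyset$ and $V\setminus(A\cup B)\neq\emptyset$. *)

theory Defs
  imports "HOL-Analysis.Analysis" "HOL-Library.Cardinality"
begin

text \<open>
  The vertex set of the complete graph is the universe of a finite type with at least two
  elements (class \<open>card2\<close>), so that \<open>n = CARD('v)\<close> and \<open>n \<ge> 2\<close>. The edges form a
  type as well, so that \<open>real ^ 'v edge\<close> is the space of edge-indexed vectors.
\<close>

typedef (overloaded) ('v::card2) edge = "{e :: 'v set. card e = 2}"
  morphisms ends Abs_edge
proof -
  have "2 \<le> CARD('v)" by (rule two_le_card)
  then obtain e :: "'v set" where "card e = 2"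
    using obtain_subset_with_card_n by metis
  then show ?thesis by blast
qed

instance edge :: (card2) finite
proof
  have "(UNIV :: 'a edge set) = Abs_edge ` {e. card e = 2}"
    using type_definition.univ[OF type_definition_edge] .
  then show "finite (UNIV :: 'a edge set)" by (metis finite finite_imageI)
qed

lemma card_edge: "CARD('v::card2 edge) = CARD('v) choose 2"
proof -
  have "CARD('v edge) = card {e :: 'v set. card e = 2}"
    by (rule type_definition.card[OF type_definition_edge])
  then show ?thesis using n_subsets[of "UNIV :: 'v set" 2] by simp
qed

definition cut_vector :: "'v::card2 set \<Rightarrow> real ^ 'v edge" where
  "cut_vector S = (\<chi> e. if card (S \<inter> ends e) = 1 then 1 else 0)"

definition is_cut :: "'v::card2 set \<Rightarrow> bool" where
  "is_cut X \<longleftrightarrow> X \<noteq> {} \<and> X \<noteq> UNIV"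

text \<open>Cuts are represented by subsets, a subset and its complement being the same cut.\<close>

definition same_cut :: "'v::card2 set \<Rightarrow> 'v set \<Rightarrow> bool" where
  "same_cut X Y \<longleftrightarrow> X = Y \<or> X = - Y"

definition K_max_plus :: "'v::card2 set \<Rightarrow> (real ^ 'v edge) set" where
  "K_max_plus X = {c. (\<forall>e. 0 \<le> c $ e) \<and>
     (\<forall>Y. is_cut Y \<longrightarrow> c \<bullet> cut_vector X \<ge> c \<bullet> cut_vector Y)}"

definition adjacent_cones :: "'v::card2 set \<Rightarrow> 'v set \<Rightarrow> bool" where
  "adjacent_cones X Y \<longleftrightarrow>
     aff_dim (K_max_plus X \<inter> K_max_plus Y) = int (CARD('v) choose 2) - 1"

definition crossing :: "'v set \<Rightarrow> 'v set \<Rightarrow> bool" where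
  "crossing A B \<longleftrightarrow>
     A \<inter> B \<noteq> {} \<and> A - B \<noteq> {} \<and> B - A \<noteq> {} \<and> UNIV - (A \<union> B) \<noteq> {}"

end

theory Submission
  imports Defs
begin

text \<open>
  Let \<open>B\<close> be the symmetric difference of \<open>X\<close> and \<open>Y\<close>. An edge belongs to both cuts iff its ends lie
  in the same one of the two blocks \<open>B\<close> and \<open>- B\<close> and are separated by \<open>X\<close>, so the common edges form
  a complete bipartite graph on each block. Condition (i) or (ii) holds iff both graphs are
  connected.

  If they are, then a cut containing all common edges is \<open>X\<close> or \<open>Y\<close>. Giving the common edges a huge
  weight and balancing positive weights on the other ones makes \<open>X\<close> and \<open>Y\<close> the only maximum
  cuts, and this persists under small perturbations inside the hyperplane orthogonal to
  \<open>v(X) - v(Y)\<close>, which contains the intersection of the cones.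

  If one is not, then its block contains two vertices \<open>b\<close> and \<open>b'\<close>, and no common edge ends at \<open>b\<close>.
  Moving \<open>b\<close> to the other side in both cuts, one gets two (possibly empty) cuts that together contain
  every edge at least as often as \<open>X\<close> and \<open>Y\<close> do, and the edge between \<open>b\<close> and \<open>b'\<close> twice more.
  Hence this edge has weight zero throughout the intersection of the cones, which cuts the dimension
  down once more.
\<close>

lemma aff_dim_eq_if_Int_open_subset:
  fixes H :: "'a::euclidean_space set"
  assumes "convex H" "open U" "H \<inter> U \<noteq> {}" "H \<inter> U \<subseteq> S" "S \<subseteq> H"
  shows "aff_dim S = aff_dim H"
proof (rule antisym)
  show "aff_dim S \<le> aff_dim H"
    using \<open>S \<subseteq> H\<close> by (rule aff_dim_subset)
  have "aff_dim H = aff_dim (H \<inter> U)"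
    using assms(1-3) by (simp add: aff_dim_convex_Int_open)
  also have "\<dots> \<le> aff_dim S"
    using \<open>H \<inter> U \<subseteq> S\<close> by (rule aff_dim_subset)
  finally show "aff_dim H \<le> aff_dim S" .
qed

lemma inner_vec_mono:
  fixes c u v :: "real ^ 'n"
  assumes "\<And>i. 0 \<le> c $ i" "\<And>i. u $ i \<le> v $ i"
  shows "c \<bullet> u \<le> c \<bullet> v"
  unfolding inner_vec_def inner_real_def by (intro sum_mono mult_left_mono assms)

lemma positive_weight_balancing_two_sets:
  assumes "finite A" "finite B" "\<not> A \<subseteq> B" "\<not> B \<subseteq> A"
  obtains w :: "'a \<Rightarrow> real" where "\<And>x. 0 < w x" "sum w A = sum w B"
proof
  let ?w = "\<lambda>x. if x \<in> A - B then real (card (B - A))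
    else if x \<in> B - A then real (card (A - B)) else 1"
  show "0 < ?w x" for x
    using assms by (simp add: card_gt_0_iff)
  have "sum ?w (A - B) = (\<Sum>x\<in>A - B. card (B - A))"
    "sum ?w (B - A) = (\<Sum>x\<in>B - A. card (A - B))"
    by (auto intro: sum.cong)
  then have "sum ?w (A - B) = sum ?w (B - A)"
    by simp
  then show "sum ?w A = sum ?w B"
    using assms(1,2) by (simp only: sum.Int_Diff[of A _ B] sum.Int_Diff[of B _ A] Int_commute)
qed

lemma positive_weight_favouring_supersets_of_Int:
  fixes A B :: "'a::finite set"
  assumes "\<not> A \<subseteq> B" "\<not> B \<subseteq> A"
  obtains w :: "'a \<Rightarrow> real" where "\<And>x. 0 < w x" "sum w A = sum w B"
    "\<And>C. \<not> A \<inter> B \<subseteq> C \<Longrightarrow> sum w C < sum w A"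
proof -
  obtain u :: "'a \<Rightarrow> real" where u_pos: "\<And>x. 0 < u x" and u_balanced: "sum u A = sum u B"
    using positive_weight_balancing_two_sets[OF finite finite assms] by blast
  define w where "w x = u x + (if x \<in> A \<inter> B then sum u UNIV else 0)" for x
  have sum_w: "sum w C = sum u C + card (C \<inter> (A \<inter> B)) * sum u UNIV" for C
    unfolding w_def by (simp add: sum.distrib sum.If_cases del: Int_iff)
  have sum_u_nonneg: "0 \<le> sum u C" for C
    by (simp add: sum_nonneg u_pos less_imp_le)
  show ?thesis
  proof
    show "0 < w x" for x
      using u_pos sum_u_nonneg[of UNIV] by (simp add: w_def add_pos_nonneg)
    show "sum w A = sum w B"
      using u_balanced by (simp add: sum_w Int_ac)
    show "sum w C < sum w A" if "\<not> A \<inter> B \<subseteq> C" for C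
    proof -
      have "C \<inter> (A \<inter> B) \<subset> A \<inter> B"
        using that by blast
      then have "card (C \<inter> (A \<inter> B)) < card (A \<inter> B)"
        by (simp add: psubset_card_mono)
      then have "real (card (C \<inter> (A \<inter> B)) + 1) \<le> card (A \<inter> B)"
        by linarith
      then have "(card (C \<inter> (A \<inter> B)) + 1) * sum u UNIV \<le> card (A \<inter> B) * sum u UNIV"
        using sum_u_nonneg by (rule mult_right_mono)
      moreover have "sum u C \<le> sum u UNIV"
        using u_pos by (intro sum_mono2) (auto simp: less_imp_le)
      moreover have "0 < sum u A"
        using assms u_pos by (intro sum_pos) auto
      ultimately show ?thesis
        by (simp add: sum_w algebra_simps)
    qed
  qed
qed

definition cut_edges :: "'v::card2 set \<Rightarrow> 'v edge set" where
  "cut_edges S = {e. card (S \<inter> ends e) = 1}"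

lemma ends_obtain:
  obtains i j where "ends e = {i, j}" "i \<noteq> j"
  using ends[of e] by (auto simp: card_2_iff)

lemma edge_obtain:
  assumes "i \<noteq> j"
  obtains e where "ends e = {i, j}"
proof
  show "ends (Abs_edge {i, j}) = {i, j}"
    using assms by (simp add: Abs_edge_inverse)
qed

lemma mem_cut_edges_iff:
  assumes "ends e = {i, j}"
  shows "e \<in> cut_edges S \<longleftrightarrow> (i \<in> S) \<noteq> (j \<in> S)"
proof -
  have "i \<noteq> j"
    using assms ends[of e] by auto
  moreover have "S \<inter> {i, j} = (if i \<in> S then {i} else {}) \<union> (if j \<in> S then {j} else {})"
    by auto
  ultimately show ?thesis
    by (simp add: cut_edges_def assms)
qed

lemma cut_edges_Compl: "cut_edges (- S) = cut_edges S"
proof (rule set_eqI)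
  fix e :: "'a edge"
  obtain i j where "ends e = {i, j}"
    by (rule ends_obtain)
  then show "e \<in> cut_edges (- S) \<longleftrightarrow> e \<in> cut_edges S"
    by (simp add: mem_cut_edges_iff)
qed

lemma mem_cut_edges_sym_diff_singleton_iff:
  "e \<in> cut_edges (sym_diff S {b}) \<longleftrightarrow> (e \<in> cut_edges S) \<noteq> (b \<in> ends e)"
proof -
  obtain i j where "ends e = {i, j}" "i \<noteq> j"
    by (rule ends_obtain)
  then show ?thesis
    by (auto simp: mem_cut_edges_iff)
qed

lemma separated_if_common_cut_edges_subset:
  assumes "cut_edges X \<inter> cut_edges Y \<subseteq> cut_edges Z"
    and "(i \<in> X) \<noteq> (j \<in> X)" "(i \<in> Y) \<noteq> (j \<in> Y)"
  shows "(i \<in> Z) \<noteq> (j \<in> Z)"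
proof -
  have "i \<noteq> j"
    using assms(2) by auto
  then obtain e where "ends e = {i, j}"
    by (rule edge_obtain)
  then show ?thesis
    using assms mem_cut_edges_iff by blast
qed

lemma cut_vector_nth: "cut_vector S $ e = (if e \<in> cut_edges S then 1 else 0)"
  by (simp add: cut_vector_def cut_edges_def)

lemma cut_vector_eq_iff: "cut_vector S = cut_vector T \<longleftrightarrow> cut_edges S = cut_edges T"
  by (auto simp: vec_eq_iff cut_vector_nth split: if_splits)

lemma inner_cut_vector: "c \<bullet> cut_vector S = (\<Sum>e\<in>cut_edges S. c $ e)"
  by (simp add: inner_vec_def cut_vector_nth if_distrib sum.If_cases cong: if_cong)

text \<open>For nonnegative weights the sets \<open>{}\<close> and \<open>UNIV\<close>, which are not cuts, may compete as well.\<close>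

lemma K_max_plus_iff:
  "c \<in> K_max_plus X \<longleftrightarrow>
    (\<forall>e. 0 \<le> c $ e) \<and> (\<forall>Z. c \<bullet> cut_vector Z \<le> c \<bullet> cut_vector X)"
proof -
  have "c \<bullet> cut_vector Z \<le> c \<bullet> cut_vector X" if "\<forall>e. 0 \<le> c $ e" "\<not> is_cut Z" for Z
  proof -
    have "card (ends e) \<noteq> 1" for e :: "'a edge"
      using ends[of e] by simp
    then have "cut_edges Z = {}"
      using that(2) by (auto simp: is_cut_def cut_edges_def)
    then show ?thesis
      using that(1) by (simp add: inner_cut_vector sum_nonneg)
  qed
  then show ?thesis
    by (auto simp: K_max_plus_def)
qed

definition tie_hyperplane :: "'v::card2 set \<Rightarrow> 'v set \<Rightarrow> (real ^ 'v edge) set" where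
  "tie_hyperplane X Y = {c. c \<bullet> cut_vector X = c \<bullet> cut_vector Y}"

lemma tie_hyperplane_eq: "tie_hyperplane X Y = {c. (cut_vector X - cut_vector Y) \<bullet> c = 0}"
  by (simp add: tie_hyperplane_def inner_diff_left inner_diff_right inner_commute)

lemma affine_tie_hyperplane: "affine (tie_hyperplane X Y)"
  by (simp add: tie_hyperplane_eq affine_hyperplane)

lemma K_max_plus_Int_subset_tie_hyperplane: "K_max_plus X \<inter> K_max_plus Y \<subseteq> tie_hyperplane X Y"
  by (auto simp: K_max_plus_iff tie_hyperplane_def intro: antisym)

lemma adjacent_cones_iff_aff_dim_tie_hyperplane:
  assumes "cut_edges X \<noteq> cut_edges Y"
  shows "adjacent_cones X Y \<longleftrightarrow>
    aff_dim (K_max_plus X \<inter> K_max_plus Y) = aff_dim (tie_hyperplane X Y)"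
proof -
  have "1 \<le> CARD('a edge)"
    by (simp add: Suc_le_eq)
  then show ?thesis
    using assms
    by (simp add: adjacent_cones_def tie_hyperplane_eq aff_dim_hyperplane cut_vector_eq_iff
        of_nat_diff flip: card_edge)
qed

lemma adjacent_cones_if_only_maximum_cuts:
  assumes neq: "cut_edges X \<noteq> cut_edges Y"
    and pos: "\<And>e. 0 < c $ e"
    and tie: "c \<bullet> cut_vector X = c \<bullet> cut_vector Y"
    and less: "\<And>Z. \<not> same_cut Z X \<Longrightarrow> \<not> same_cut Z Y \<Longrightarrow> c \<bullet> cut_vector Z < c \<bullet> cut_vector X"
  shows "adjacent_cones X Y"
proof -
  define U where "U = (\<Inter>e. {a. 0 < a $ e}) \<inter>
    (\<Inter>Z\<in>{Z. \<not> same_cut Z X \<and> \<not> same_cut Z Y}. {a. a \<bullet> cut_vector Z < a \<bullet> cut_vector X})"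
  have "open U"
    unfolding U_def
    by (intro open_Int open_INT finite ballI open_Collect_less continuous_intros)
  moreover have "c \<in> tie_hyperplane X Y \<inter> U"
    using assms by (simp add: tie_hyperplane_def U_def)
  moreover have "tie_hyperplane X Y \<inter> U \<subseteq> K_max_plus X \<inter> K_max_plus Y"
  proof
    fix a assume a: "a \<in> tie_hyperplane X Y \<inter> U"
    have "a \<bullet> cut_vector Z \<le> a \<bullet> cut_vector X" for Z
    proof (cases "same_cut Z X \<or> same_cut Z Y")
      case True
      then have "cut_vector Z = cut_vector X \<or> cut_vector Z = cut_vector Y"
        by (auto simp: same_cut_def cut_vector_eq_iff cut_edges_Compl)
      then show ?thesis
        using a by (auto simp: tie_hyperplane_def)
    next
      case False
      then show ?thesis
        using a by (auto simp: U_def less_imp_le)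
    qed
    then show "a \<in> K_max_plus X \<inter> K_max_plus Y"
      using a by (auto simp: K_max_plus_iff tie_hyperplane_def U_def less_imp_le)
  qed
  ultimately have "aff_dim (K_max_plus X \<inter> K_max_plus Y) = aff_dim (tie_hyperplane X Y)"
    using K_max_plus_Int_subset_tie_hyperplane affine_imp_convex[OF affine_tie_hyperplane]
    by (intro aff_dim_eq_if_Int_open_subset[of _ U]) auto
  then show ?thesis
    using neq by (simp add: adjacent_cones_iff_aff_dim_tie_hyperplane)
qed

lemma adjacent_cones_if_common_cut_edges_determine:
  assumes "\<not> cut_edges X \<subseteq> cut_edges Y" "\<not> cut_edges Y \<subseteq> cut_edges X"
    and determine: "\<And>Z. cut_edges X \<inter> cut_edges Y \<subseteq> cut_edges Z \<Longrightarrow> same_cut Z X \<or> same_cut Z Y"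
  shows "adjacent_cones X Y"
proof -
  obtain w :: "'a edge \<Rightarrow> real" where pos: "\<And>e. 0 < w e"
    and tie: "sum w (cut_edges X) = sum w (cut_edges Y)"
    and less: "\<And>C. \<not> cut_edges X \<inter> cut_edges Y \<subseteq> C \<Longrightarrow> sum w C < sum w (cut_edges X)"
    using positive_weight_favouring_supersets_of_Int[OF assms(1,2)] by blast
  show ?thesis
  proof (rule adjacent_cones_if_only_maximum_cuts)
    show "cut_edges X \<noteq> cut_edges Y"
      using assms(1) by blast
    show "0 < vec_lambda w $ e" for e
      by (simp add: pos)
    show "vec_lambda w \<bullet> cut_vector X = vec_lambda w \<bullet> cut_vector Y"
      by (simp add: inner_cut_vector tie)
    show "vec_lambda w \<bullet> cut_vector Z < vec_lambda w \<bullet> cut_vector X"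
      if "\<not> same_cut Z X" "\<not> same_cut Z Y" for Z
      using less[of "cut_edges Z"] determine[of Z] that by (auto simp: inner_cut_vector)
  qed
qed

lemma K_max_plus_Int_nth_eq_0_if_no_common_cut_edge_at:
  assumes c: "c \<in> K_max_plus X \<inter> K_max_plus Y"
    and no_common: "\<And>f. b \<in> ends f \<Longrightarrow> f \<notin> cut_edges X \<inter> cut_edges Y"
    and e: "b \<in> ends e" "e \<notin> cut_edges X" "e \<notin> cut_edges Y"
  shows "c $ e = 0"
proof -
  let ?X' = "sym_diff X {b}" and ?Y' = "sym_diff Y {b}"
  have nonneg: "0 \<le> c $ f" for f
    using c by (simp add: K_max_plus_iff)
  have "(cut_vector X + cut_vector Y + 2 *\<^sub>R axis e 1) $ f
      \<le> (cut_vector ?X' + cut_vector ?Y') $ f" for f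
    using no_common[of f] e
    by (auto simp: cut_vector_nth mem_cut_edges_sym_diff_singleton_iff axis_def)
  then have "c \<bullet> (cut_vector X + cut_vector Y + 2 *\<^sub>R axis e 1)
      \<le> c \<bullet> (cut_vector ?X' + cut_vector ?Y')"
    using nonneg by (rule inner_vec_mono[rotated])
  moreover have "c \<bullet> cut_vector ?X' \<le> c \<bullet> cut_vector X" "c \<bullet> cut_vector ?Y' \<le> c \<bullet> cut_vector Y"
    using c by (simp_all add: K_max_plus_iff)
  ultimately have "c $ e \<le> 0"
    by (simp add: inner_add_right inner_axis)
  then show ?thesis
    using nonneg by (rule antisym)
qed

lemma not_adjacent_cones_if_nth_eq_0:
  assumes neq: "cut_edges X \<noteq> cut_edges Y"
    and e: "e \<in> cut_edges X \<longleftrightarrow> e \<in> cut_edges Y"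
    and zero: "\<And>c. c \<in> K_max_plus X \<inter> K_max_plus Y \<Longrightarrow> c $ e = 0"
  shows "\<not> adjacent_cones X Y"
proof -
  let ?L = "tie_hyperplane X Y \<inter> {c. axis e 1 \<bullet> c = 0}"
  have "K_max_plus X \<inter> K_max_plus Y \<subseteq> ?L"
    using K_max_plus_Int_subset_tie_hyperplane zero by (auto simp: inner_axis')
  then have "aff_dim (K_max_plus X \<inter> K_max_plus Y) \<le> aff_dim ?L"
    by (rule aff_dim_subset)
  also have "aff_dim ?L < aff_dim (tie_hyperplane X Y)"
  proof -
    have "axis e 1 \<in> tie_hyperplane X Y - ?L"
      using e by (simp add: tie_hyperplane_def inner_axis' cut_vector_nth)
    moreover have "0 \<in> ?L"
      by (simp add: tie_hyperplane_def)
    ultimately show ?thesis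
      by (auto simp: aff_dim_affine_Int_hyperplane affine_tie_hyperplane)
  qed
  finally show ?thesis
    using neq by (simp add: adjacent_cones_iff_aff_dim_tie_hyperplane)
qed

text \<open>This is connectedness of the complete bipartite graph with sides \<open>W \<inter> S\<close> and \<open>W - S\<close>.\<close>

definition bipartition_connected :: "'a set \<Rightarrow> 'a set \<Rightarrow> bool" where
  "bipartition_connected S W \<longleftrightarrow> card W = 1 \<or> W \<inter> S \<noteq> {} \<and> W - S \<noteq> {}"

lemma bipartition_eq_if_connected:
  assumes "bipartition_connected S W"
    and sep: "\<And>i j. i \<in> W \<inter> S \<Longrightarrow> j \<in> W - S \<Longrightarrow> (i \<in> Z) \<noteq> (j \<in> Z)"
  shows "W \<inter> Z = W \<inter> S \<or> W \<inter> Z = W - S"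
  using assms(1) unfolding bipartition_connected_def
proof
  assume "card W = 1"
  then obtain b where "W = {b}"
    by (rule card_1_singletonE)
  then show ?thesis
    by auto
next
  assume "W \<inter> S \<noteq> {} \<and> W - S \<noteq> {}"
  then obtain p q where "p \<in> W \<inter> S" "q \<in> W - S"
    by blast
  then show ?thesis
    using sep[of p] sep[of _ q] by blast
qed

lemma cut_edges_subset_imp_same_cut:
  assumes "is_cut X" "cut_edges X \<subseteq> cut_edges Y"
  shows "same_cut X Y"
proof -
  have separated: "(i \<in> Y) \<noteq> (j \<in> Y)" if "i \<in> X" "j \<notin> X" for i j
    using separated_if_common_cut_edges_subset[of X X Y i j] assms(2) that by simp
  have "bipartition_connected X UNIV"
    using \<open>is_cut X\<close> by (auto simp: bipartition_connected_def is_cut_def)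
  then have "UNIV \<inter> Y = UNIV \<inter> X \<or> UNIV \<inter> Y = UNIV - X"
    by (rule bipartition_eq_if_connected) (use separated in blast)
  then show ?thesis
    by (auto simp: same_cut_def)
qed

lemma common_cut_edges_determine_if_bipartition_connected:
  assumes "bipartition_connected X (sym_diff X Y)" "bipartition_connected X (sym_diff (- X) Y)"
    and "cut_edges X \<inter> cut_edges Y \<subseteq> cut_edges Z"
  shows "same_cut Z X \<or> same_cut Z Y"
proof -
  note sep = separated_if_common_cut_edges_subset[OF assms(3)]
  let ?B = "sym_diff X Y" and ?C = "sym_diff (- X) Y"
  have "?B \<inter> Z = ?B \<inter> X \<or> ?B \<inter> Z = ?B - X"
    by (rule bipartition_eq_if_connected[OF assms(1)]) (use sep in blast)
  moreover have "?C \<inter> Z = ?C \<inter> X \<or> ?C \<inter> Z = ?C - X"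
    by (rule bipartition_eq_if_connected[OF assms(2)]) (use sep in blast)
  ultimately consider "Z = X" | "Z = Y" | "Z = - X" | "Z = - Y"
    by blast
  then show ?thesis
    by cases (auto simp: same_cut_def)
qed

lemma bipartition_connected_if_adjacent_cones:
  assumes neq: "cut_edges X \<noteq> cut_edges Y" and adj: "adjacent_cones X Y"
    and W: "W = sym_diff X Y \<or> W = sym_diff (- X) Y" "W \<noteq> {}"
  shows "bipartition_connected X W"
proof (rule ccontr)
  assume "\<not> bipartition_connected X W"
  then have unsplit: "W \<subseteq> X \<or> W \<inter> X = {}" and "card W \<noteq> 1"
    by (auto simp: bipartition_connected_def)
  then obtain b b' where b: "b \<in> W" "b' \<in> W" "b \<noteq> b'"
    using \<open>W \<noteq> {}\<close> by (metis is_singletonI' is_singleton_altdef)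
  obtain e where e: "ends e = {b, b'}"
    using \<open>b \<noteq> b'\<close> by (rule edge_obtain)
  have mem_W: "(i \<in> W \<longleftrightarrow> j \<in> W) \<longleftrightarrow> ((i \<in> X) = (j \<in> X)) = ((i \<in> Y) = (j \<in> Y))" for i j
    using W(1) by (elim disjE) auto
  have same_X: "i \<in> X \<longleftrightarrow> j \<in> X" if "i \<in> W" "j \<in> W" for i j
    using unsplit that by blast
  have e_notin: "e \<notin> cut_edges X" "e \<notin> cut_edges Y"
    using same_X[of b b'] mem_W[of b b'] b by (simp_all add: mem_cut_edges_iff[OF e])
  have "f \<notin> cut_edges X \<inter> cut_edges Y" if "b \<in> ends f" for f
  proof -
    obtain i j where f: "ends f = {i, j}"
      by (rule ends_obtain)
    then have "b = i \<or> b = j"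
      using that by simp
    then show ?thesis
      using same_X[of i j] mem_W[of i j] b(1)
      by (auto simp: mem_cut_edges_iff[OF f])
  qed
  then have "c $ e = 0" if "c \<in> K_max_plus X \<inter> K_max_plus Y" for c
    using K_max_plus_Int_nth_eq_0_if_no_common_cut_edge_at[OF that] e e_notin by blast
  then show False
    using not_adjacent_cones_if_nth_eq_0[OF neq] e_notin adj by blast
qed

lemma adjacent_cones_iff_bipartition_connected:
  assumes "is_cut X" "is_cut Y" "\<not> same_cut X Y"
  shows "adjacent_cones X Y \<longleftrightarrow>
    bipartition_connected X (sym_diff X Y) \<and> bipartition_connected X (sym_diff (- X) Y)"
proof -
  have not_subset: "\<not> cut_edges X \<subseteq> cut_edges Y" "\<not> cut_edges Y \<subseteq> cut_edges X"
    using assms cut_edges_subset_imp_same_cut by (auto simp: same_cut_def)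
  then have neq: "cut_edges X \<noteq> cut_edges Y"
    by blast
  have "X \<noteq> Y" "- X \<noteq> Y"
    using \<open>\<not> same_cut X Y\<close> by (auto simp: same_cut_def)
  then have nonempty: "sym_diff X Y \<noteq> {}" "sym_diff (- X) Y \<noteq> {}"
    by auto
  show ?thesis
  proof
    assume "adjacent_cones X Y"
    then show "bipartition_connected X (sym_diff X Y) \<and> bipartition_connected X (sym_diff (- X) Y)"
      using bipartition_connected_if_adjacent_cones[OF neq] nonempty by simp
  next
    assume "bipartition_connected X (sym_diff X Y) \<and> bipartition_connected X (sym_diff (- X) Y)"
    then show "adjacent_cones X Y"
      by (intro adjacent_cones_if_common_cut_edges_determine[OF not_subset]
          common_cut_edges_determine_if_bipartition_connected) simp_all
  qed
qed

lemma bipartition_connected_sym_diff_iff: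
  fixes X Y :: "'v::card2 set"
  assumes "is_cut X" "is_cut Y"
  shows "bipartition_connected X (sym_diff X Y) \<and> bipartition_connected X (sym_diff (- X) Y) \<longleftrightarrow>
    crossing X Y \<or> card (sym_diff X Y) = 1 \<or> card (sym_diff (- X) Y) = 1"
proof -
  have block_sides:
    "sym_diff X Y \<inter> X = X - Y" "sym_diff X Y - X = Y - X"
    "sym_diff (- X) Y \<inter> X = X \<inter> Y" "sym_diff (- X) Y - X = UNIV - (X \<union> Y)"
    by auto
  have inside_and_outside_nonempty: "A \<inter> B \<noteq> {} \<and> UNIV - (A \<union> B) \<noteq> {}"
    if "is_cut A" "is_cut B" and singleton: "card (sym_diff A B) = 1" for A B :: "'v set"
  proof -
    obtain b where "sym_diff A B = {b}"
      using singleton by (rule card_1_singletonE)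
    then have "A - B \<subseteq> {b}" "B - A \<subseteq> {b}" "b \<in> A \<longleftrightarrow> b \<notin> B"
      by blast+
    then show ?thesis
      using that(1,2) unfolding is_cut_def by blast
  qed
  have "X \<inter> Y \<noteq> {} \<and> UNIV - (X \<union> Y) \<noteq> {}" if "card (sym_diff X Y) = 1"
    using inside_and_outside_nonempty[OF assms that] .
  moreover have "X - Y \<noteq> {} \<and> Y - X \<noteq> {}" if "card (sym_diff (- X) Y) = 1"
  proof -
    have "is_cut (- X)"
      using assms(1) by (auto simp: is_cut_def)
    then show ?thesis
      using inside_and_outside_nonempty[OF _ assms(2) that] by blast
  qed
  ultimately show ?thesis
    unfolding bipartition_connected_def crossing_def block_sides by argo
qed

theorem theorem3:
  fixes X Y :: "'v::card2 set"
  assumes "is_cut X" and "is_cut Y" and "\<not> same_cut X Y"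
  shows "adjacent_cones X Y \<longleftrightarrow>
    crossing X Y \<or>
    (card (sym_diff X Y) = 1 \<or> card (sym_diff (- X) Y) = 1 \<or>
     card (sym_diff X (- Y)) = 1 \<or> card (sym_diff (- X) (- Y)) = 1)"
proof -
  have "sym_diff X (- Y) = sym_diff (- X) Y" "sym_diff (- X) (- Y) = sym_diff X Y"
    by auto
  then show ?thesis
    using adjacent_cones_iff_bipartition_connected[OF assms]
      bipartition_connected_sym_diff_iff[OF assms(1,2)]
    by argo
qed

end
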